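(* Let $\mathcal Q(C_a,C_b)$ be an HGP code of length $n$ (taken from a sequence of HGP codes satisfying the scaling assumptions in the context, and with logical Pauli operators given by SLT bases). (a) For any two distinct logical qubits $(i_1,h_1,L)$ and $(i_2,h_2,L)$ in the same sector there exists a Clifford circuit $\mathsf C$ that implements the targeted logical gate $\overline{CNOT}_{(i_1,h_1,L)\to(i_2,h_2,L)}$. (b) For any two logical qubits $(i,h,L)$ and $(j,l,R)$ in different sectors there exists a Clifford circuit $\mathsf C$ that implements the targeted logical gate $\overline{CNOT}_{(i,h,L)\to(j,l,R)}$. In both cases the support size $\chi(\mathsf C)$ and the depth $\delta(\mathsf C)$ are of order $\Theta(\sqrt n)$.
   Context: All vectors are row vectors over $\mathbb F_2$; $e_i$ denotes a standard basis vector. Given binary matrices $H_a$ ($m_a\times n_a$), $H_b$ ($m_b\times n_b$), parity-check matrices of classical codes $C_a=\ker H_a$, $C_b=\ker H_b$, the hypergraph product (HGP) code $\mathcal Q(C_a,C_b)$ is the CSS code on $n=n_an_b+m_am_b$ qubits with $$H_X=[H_a\otimes I_{n_b}\,|\,I_{m_a}\otimes H_b^{\top}],\qquad H_Z=[I_{n_a}\otimes H_b\,|\,H_a^{\top}\otimes I_{m_b}].$$ Its stabilizer generators are the $X$-type Pauli operators supported on the rows of $H_X$ and the $Z$-type Pauli operators supported on the rows of $H_Z$. The first $n_an_b$ qubits form the left sector and the remaining ones the right sector. An SLT basis of a subspace is a basis $\{a_i\}$ indexed by distinct coordinates $i$ (pivots) such that $(a_i)_i=1$ and $(a_{i'})_i=0$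 for pivots $i'\ne i$. Let $\{a_i\},\{\alpha_j\},\{b_h\},\{\beta_l\}$ be SLT bases of $\ker H_a,\ker H_a^{\top},\ker H_b,\ker H_b^{\top}$. Logical qubits are labelled $(i,h,L)$ ($i,h$ pivots of $\{a_i\},\{b_h\}$) and $(j,l,R)$ ($j,l$ pivots of $\{\alpha_j\},\{\beta_l\}$). Logical Paulis: $\overline X_{i,h,L}$ is the $X$-type operator with support vector $[e_i\otimes b_h|0]$, $\overline Z_{i,h,L}$ the $Z$-type operator with $[a_i\otimes e_h|0]$, $\overline X_{j,l,R}$ the $X$-type operator with $[0|\alpha_j\otimes e_l]$, $\overline Z_{j,l,R}$ the $Z$-type operator with $[0|e_j\otimes\beta_l]$. Scaling assumptions: a sequence of HGP codes with $n\to\infty$, where $n_a,n_b$ scale in proportion to $\sqrt n$ and the dimensions and distances of the constituent codes are a constant proportion of their lengths, so that the Hamming weights of all vectors in the four SLT bases are $\Theta(\sqrt n)$ (uniformly). A Clifford circuit $\mathsf C$ is a finite sequence of one- and two-qubit gates on the $n$ physical qubits from $\{H,S,CNOT,CZ,SWAP\}$ and single-qubit Paulis (no ancillas), enacting a unitary $U$. Its support is the smallest set of qubits such that $U$ acts as the identity on every qubit outside it, with size $\chi(\mathsf C)$; its depth $\delta(\mathsf C)$ is the minimum number of layers into which its gates can be arranged so that gates in the same layer do not overlap on qubits. $\mathsf C$ implements a logical gate $g$ if $USU^\dagger=S$ for every stabilizer generator $S$ and conjugation by $U$ acts on the logical Paulis as $g$ prescribes, up to global phases of logical Paulis. The gate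 $\overline{CNOT}_{c\to t}$ maps $\overline X_c\mapsto\overline X_c\overline X_t$, $\overline Z_t\mapsto\overline Z_c\overline Z_t$, and fixes all other logical Paulis $\overline X,\overline Z$. *)

theory Defs
  imports
    Complex_Main
    "HOL-Library.Z2"
    "HOL-Library.Landau_Symbols"
    "Jordan_Normal_Form.Matrix_Kernel"
    "Jordan_Normal_Form.Schur_Decomposition"
begin

section \<open>Binary linear algebra\<close>

definition kron :: "'a::semiring_0 mat \<Rightarrow> 'a mat \<Rightarrow> 'a mat" where
  "kron A B = mat (dim_row A * dim_row B) (dim_col A * dim_col B)
     (\<lambda>(i, j). A $$ (i div dim_row B, j div dim_col B) * B $$ (i mod dim_row B, j mod dim_col B))"

definition kron_vec :: "'a::semiring_0 vec \<Rightarrow> 'a vec \<Rightarrow> 'a vec" where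
  "kron_vec v w = vec (dim_vec v * dim_vec w) (\<lambda>i. v $ (i div dim_vec w) * w $ (i mod dim_vec w))"

definition hcat :: "'a::zero mat \<Rightarrow> 'a mat \<Rightarrow> 'a mat" where
  "hcat A B = four_block_mat A B (0\<^sub>m 0 (dim_col A)) (0\<^sub>m 0 (dim_col B))"

definition hamming_weight :: "bit vec \<Rightarrow> nat" where
  "hamming_weight v = card {i. i < dim_vec v \<and> v $ i = 1}"

text \<open>Minimum distance of the code with parity-check matrix \<open>A\<close>; the infimum is the junk value
  0 when the code has no nonzero codeword.\<close>

definition code_distance :: "bit mat \<Rightarrow> nat" where
  "code_distance A = Inf {hamming_weight v | v. v \<in> mat_kernel A \<and> v \<noteq> 0\<^sub>v (dim_col A)}"

text \<open>\<open>P\<close> is the set of pivots, and \<open>a i\<close> is the basis vector indexed by the pivot \<open>i\<close>; values of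
  \<open>a\<close> outside \<open>P\<close> are irrelevant.\<close>

definition slt_basis :: "bit mat \<Rightarrow> nat set \<Rightarrow> (nat \<Rightarrow> bit vec) \<Rightarrow> bool" where
  "slt_basis A P a \<longleftrightarrow>
     P \<subseteq> {..<dim_col A} \<and> inj_on a P \<and> kernel.basis (dim_col A) A (a ` P) \<and>
     (\<forall>i\<in>P. a i $ i = 1 \<and> (\<forall>i'\<in>P. i' \<noteq> i \<longrightarrow> a i' $ i = 0))"


section \<open>Hypergraph product codes with SLT bases\<close>

text \<open>The suffix \<open>T\<close> marks the pivots and basis vectors of the kernel of the transposed matrix.\<close>

record hgp =
  HA :: "bit mat"
  HB :: "bit mat"
  pivA :: "nat set"
  basA :: "nat \<Rightarrow> bit vec"
  pivAT :: "nat set"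
  basAT :: "nat \<Rightarrow> bit vec"
  pivB :: "nat set"
  basB :: "nat \<Rightarrow> bit vec"
  pivBT :: "nat set"
  basBT :: "nat \<Rightarrow> bit vec"

definition hgp_slt :: "hgp \<Rightarrow> bool" where
  "hgp_slt Q \<longleftrightarrow>
     slt_basis (HA Q) (pivA Q) (basA Q) \<and> slt_basis (transpose_mat (HA Q)) (pivAT Q) (basAT Q) \<and>
     slt_basis (HB Q) (pivB Q) (basB Q) \<and> slt_basis (transpose_mat (HB Q)) (pivBT Q) (basBT Q)"

abbreviation na :: "hgp \<Rightarrow> nat" where "na Q \<equiv> dim_col (HA Q)"
abbreviation ma :: "hgp \<Rightarrow> nat" where "ma Q \<equiv> dim_row (HA Q)"
abbreviation nb :: "hgp \<Rightarrow> nat" where "nb Q \<equiv> dim_col (HB Q)"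
abbreviation mb :: "hgp \<Rightarrow> nat" where "mb Q \<equiv> dim_row (HB Q)"

definition hgp_length :: "hgp \<Rightarrow> nat" where
  "hgp_length Q = na Q * nb Q + ma Q * mb Q"

definition HX :: "hgp \<Rightarrow> bit mat" where
  "HX Q = hcat (kron (HA Q) (1\<^sub>m (nb Q))) (kron (1\<^sub>m (ma Q)) (transpose_mat (HB Q)))"

definition HZ :: "hgp \<Rightarrow> bit mat" where
  "HZ Q = hcat (kron (1\<^sub>m (na Q)) (HB Q)) (kron (transpose_mat (HA Q)) (1\<^sub>m (mb Q)))"

datatype lqubit = LeftQ nat nat | RightQ nat nat

definition logical_qubits :: "hgp \<Rightarrow> lqubit set" where
  "logical_qubits Q =
     {LeftQ i h | i h. i \<in> pivA Q \<and> h \<in> pivB Q} \<union> {RightQ j l | j l. j \<in> pivAT Q \<and> l \<in> pivBT Q}"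

fun logical_X_support :: "hgp \<Rightarrow> lqubit \<Rightarrow> bit vec" where
  "logical_X_support Q (LeftQ i h) = kron_vec (unit_vec (na Q) i) (basB Q h) @\<^sub>v 0\<^sub>v (ma Q * mb Q)"
| "logical_X_support Q (RightQ j l) = 0\<^sub>v (na Q * nb Q) @\<^sub>v kron_vec (basAT Q j) (unit_vec (mb Q) l)"

fun logical_Z_support :: "hgp \<Rightarrow> lqubit \<Rightarrow> bit vec" where
  "logical_Z_support Q (LeftQ i h) = kron_vec (basA Q i) (unit_vec (nb Q) h) @\<^sub>v 0\<^sub>v (ma Q * mb Q)"
| "logical_Z_support Q (RightQ j l) = 0\<^sub>v (na Q * nb Q) @\<^sub>v kron_vec (unit_vec (ma Q) j) (basBT Q l)"


section \<open>Operators on \<open>n\<close> qubits\<close>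

text \<open>Operators on \<open>n\<close> qubits are \<open>2^n \<times> 2^n\<close> matrices.  The computational basis state
  with index \<open>x < 2^n\<close> has qubit \<open>q\<close> in the state given by the binary digit \<open>bit x q\<close> of weight \<open>2^q\<close>.\<close>

definition tensor_op :: "nat \<Rightarrow> (nat \<Rightarrow> complex mat) \<Rightarrow> complex mat" where
  "tensor_op n M = mat (2 ^ n) (2 ^ n)
     (\<lambda>(x, y). \<Prod>q<n. M q $$ (of_bool (bit x q), of_bool (bit y q)))"

text \<open>\<open>local_op n qs G\<close> applies the \<open>2^r \<times> 2^r\<close> matrix \<open>G\<close> to the \<open>r\<close> distinct qubits listed in \<open>qs\<close>
  and the identity to all other qubits.  In the basis of \<open>G\<close> the first qubit of \<open>qs\<close> is the most
  significant one.\<close>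

definition sub_index :: "nat list \<Rightarrow> nat \<Rightarrow> nat" where
  "sub_index qs x = foldl (\<lambda>i q. 2 * i + of_bool (bit x q)) 0 qs"

definition local_op :: "nat \<Rightarrow> nat list \<Rightarrow> complex mat \<Rightarrow> complex mat" where
  "local_op n qs G = mat (2 ^ n) (2 ^ n)
     (\<lambda>(x, y). if \<forall>p<n. p \<notin> set qs \<longrightarrow> bit x p = bit y p
               then G $$ (sub_index qs x, sub_index qs y) else 0)"

abbreviation pauli_X :: "complex mat" where
  "pauli_X \<equiv> mat_of_rows_list 2 [[0, 1], [1, 0]]"
abbreviation pauli_Y :: "complex mat" where
  "pauli_Y \<equiv> mat_of_rows_list 2 [[0, - \<i>], [\<i>, 0]]"
abbreviation pauli_Z :: "complex mat" where
  "pauli_Z \<equiv> mat_of_rows_list 2 [[1, 0], [0, - 1]]"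

definition X_type :: "bit vec \<Rightarrow> complex mat" where
  "X_type v = tensor_op (dim_vec v) (\<lambda>q. if v $ q = 1 then pauli_X else 1\<^sub>m 2)"

definition Z_type :: "bit vec \<Rightarrow> complex mat" where
  "Z_type v = tensor_op (dim_vec v) (\<lambda>q. if v $ q = 1 then pauli_Z else 1\<^sub>m 2)"


section \<open>Clifford circuits\<close>

datatype gate =
    GateX nat | GateY nat | GateZ nat | GateH nat | GateS nat
  | GateCNOT nat nat | GateCZ nat nat | GateSWAP nat nat

fun gate_qubits :: "gate \<Rightarrow> nat list" where
  "gate_qubits (GateX q) = [q]"
| "gate_qubits (GateY q) = [q]"
| "gate_qubits (GateZ q) = [q]"
| "gate_qubits (GateH q) = [q]"
| "gate_qubits (GateS q) = [q]"
| "gate_qubits (GateCNOT q r) = [q, r]"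
| "gate_qubits (GateCZ q r) = [q, r]"
| "gate_qubits (GateSWAP q r) = [q, r]"

text \<open>The first qubit of a CNOT is the control and the second one is the target.\<close>

fun gate_matrix :: "gate \<Rightarrow> complex mat" where
  "gate_matrix (GateX q) = pauli_X"
| "gate_matrix (GateY q) = pauli_Y"
| "gate_matrix (GateZ q) = pauli_Z"
| "gate_matrix (GateH q) =
     complex_of_real (1 / sqrt 2) \<cdot>\<^sub>m mat_of_rows_list 2 [[1, 1], [1, - 1]]"
| "gate_matrix (GateS q) = mat_of_rows_list 2 [[1, 0], [0, \<i>]]"
| "gate_matrix (GateCNOT q r) =
     mat_of_rows_list 4 [[1, 0, 0, 0], [0, 1, 0, 0], [0, 0, 0, 1], [0, 0, 1, 0]]"
| "gate_matrix (GateCZ q r) =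
     mat_of_rows_list 4 [[1, 0, 0, 0], [0, 1, 0, 0], [0, 0, 1, 0], [0, 0, 0, - 1]]"
| "gate_matrix (GateSWAP q r) =
     mat_of_rows_list 4 [[1, 0, 0, 0], [0, 0, 1, 0], [0, 1, 0, 0], [0, 0, 0, 1]]"

type_synonym circuit = "gate list"

definition clifford_circuit :: "nat \<Rightarrow> circuit \<Rightarrow> bool" where
  "clifford_circuit n C \<longleftrightarrow>
     (\<forall>g\<in>set C. distinct (gate_qubits g) \<and> set (gate_qubits g) \<subseteq> {..<n})"

text \<open>The head of the list is the gate that is applied first.\<close>

definition circuit_unitary :: "nat \<Rightarrow> circuit \<Rightarrow> complex mat" where
  "circuit_unitary n C =
     foldl (\<lambda>U g. local_op n (gate_qubits g) (gate_matrix g) * U) (1\<^sub>m (2 ^ n)) C"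

text \<open>\<open>U\<close> is the tensor product of the identity on qubit \<open>q\<close> with an operator \<open>V\<close> on the other
  qubits.  The basis states of the other qubits are represented by indices whose digit \<open>q\<close> is 0.\<close>

definition acts_as_identity_on :: "nat \<Rightarrow> complex mat \<Rightarrow> nat \<Rightarrow> bool" where
  "acts_as_identity_on n U q \<longleftrightarrow>
     (\<exists>V. \<forall>x<2 ^ n. \<forall>y<2 ^ n. U $$ (x, y) =
        (if bit x q = bit y q then V (unset_bit q x) (unset_bit q y) else 0))"

definition circuit_support :: "nat \<Rightarrow> circuit \<Rightarrow> nat set" where
  "circuit_support n C = {q. q < n \<and> \<not> acts_as_identity_on n (circuit_unitary n C) q}"

definition support_size :: "nat \<Rightarrow> circuit \<Rightarrow> nat" where
  "support_size n C = card (circuit_support n C)"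

text \<open>Gates that overlap on a qubit need not commute, so an admissible arrangement into layers keeps
  their order in the circuit.\<close>

definition layering :: "circuit \<Rightarrow> nat \<Rightarrow> (nat \<Rightarrow> nat) \<Rightarrow> bool" where
  "layering C d layer \<longleftrightarrow>
     (\<forall>i<length C. layer i < d) \<and>
     (\<forall>i j. i < j \<and> j < length C \<and> set (gate_qubits (C ! i)) \<inter> set (gate_qubits (C ! j)) \<noteq> {}
        \<longrightarrow> layer i < layer j)"

definition depth :: "circuit \<Rightarrow> nat" where
  "depth C = (LEAST d. \<exists>layer. layering C d layer)"


section \<open>Logical gates\<close>

definition conj_by :: "complex mat \<Rightarrow> complex mat \<Rightarrow> complex mat" where
  "conj_by U P = U * P * mat_adjoint U"

definition eq_up_to_phase :: "complex mat \<Rightarrow> complex mat \<Rightarrow> bool" where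
  "eq_up_to_phase A B \<longleftrightarrow> (\<exists>c. cmod c = 1 \<and> A = c \<cdot>\<^sub>m B)"

definition stabilizer_generators :: "hgp \<Rightarrow> complex mat set" where
  "stabilizer_generators Q = X_type ` set (rows (HX Q)) \<union> Z_type ` set (rows (HZ Q))"

definition logical_X :: "hgp \<Rightarrow> lqubit \<Rightarrow> complex mat" where
  "logical_X Q p = X_type (logical_X_support Q p)"

definition logical_Z :: "hgp \<Rightarrow> lqubit \<Rightarrow> complex mat" where
  "logical_Z Q p = Z_type (logical_Z_support Q p)"

text \<open>A logical gate is prescribed by the images \<open>gX p\<close>, \<open>gZ p\<close> of the logical Paulis of each
  logical qubit \<open>p\<close>.\<close>

definition implements ::
  "hgp \<Rightarrow> circuit \<Rightarrow> (lqubit \<Rightarrow> complex mat) \<Rightarrow> (lqubit \<Rightarrow> complex mat) \<Rightarrow> bool" where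
  "implements Q C gX gZ \<longleftrightarrow>
     (let U = circuit_unitary (hgp_length Q) C in
       (\<forall>S\<in>stabilizer_generators Q. conj_by U S = S) \<and>
       (\<forall>p\<in>logical_qubits Q.
          eq_up_to_phase (conj_by U (logical_X Q p)) (gX p) \<and>
          eq_up_to_phase (conj_by U (logical_Z Q p)) (gZ p)))"

definition CNOT_X :: "hgp \<Rightarrow> lqubit \<Rightarrow> lqubit \<Rightarrow> lqubit \<Rightarrow> complex mat" where
  "CNOT_X Q c t p = (if p = c then logical_X Q c * logical_X Q t else logical_X Q p)"

definition CNOT_Z :: "hgp \<Rightarrow> lqubit \<Rightarrow> lqubit \<Rightarrow> lqubit \<Rightarrow> complex mat" where
  "CNOT_Z Q c t p = (if p = t then logical_Z Q c * logical_Z Q t else logical_Z Q p)"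

definition implements_CNOT :: "hgp \<Rightarrow> circuit \<Rightarrow> lqubit \<Rightarrow> lqubit \<Rightarrow> bool" where
  "implements_CNOT Q C c t \<longleftrightarrow> implements Q C (CNOT_X Q c t) (CNOT_Z Q c t)"


section \<open>Scaling\<close>

text \<open>\<open>f k x = \<Theta>(g k)\<close> with constants that do not depend on the index \<open>x \<in> I k\<close>.\<close>

definition uniformly_Theta ::
  "(nat \<Rightarrow> 'i set) \<Rightarrow> (nat \<Rightarrow> 'i \<Rightarrow> nat) \<Rightarrow> (nat \<Rightarrow> real) \<Rightarrow> bool" where
  "uniformly_Theta I f g \<longleftrightarrow>
     (\<exists>c1>0. \<exists>c2>0. \<forall>\<^sub>F k in sequentially. \<forall>x\<in>I k.
        c1 * g k \<le> real (f k x) \<and> real (f k x) \<le> c2 * g k)"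

abbreviation sqrt_length :: "(nat \<Rightarrow> hgp) \<Rightarrow> nat \<Rightarrow> real" where
  "sqrt_length Q \<equiv> \<lambda>k. sqrt (real (hgp_length (Q k)))"

definition scaling :: "(nat \<Rightarrow> hgp) \<Rightarrow> bool" where
  "scaling Q \<longleftrightarrow>
     filterlim (\<lambda>k. hgp_length (Q k)) at_top sequentially \<and>
     (\<lambda>k. real (na (Q k))) \<in> \<Theta>(sqrt_length Q) \<and>
     (\<lambda>k. real (nb (Q k))) \<in> \<Theta>(sqrt_length Q) \<and>
     (\<lambda>k. real (kernel_dim (HA (Q k)))) \<in> \<Theta>(\<lambda>k. real (na (Q k))) \<and>
     (\<lambda>k. real (kernel_dim (HB (Q k)))) \<in> \<Theta>(\<lambda>k. real (nb (Q k))) \<and>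
     (\<lambda>k. real (code_distance (HA (Q k)))) \<in> \<Theta>(\<lambda>k. real (na (Q k))) \<and>
     (\<lambda>k. real (code_distance (HB (Q k)))) \<in> \<Theta>(\<lambda>k. real (nb (Q k))) \<and>
     uniformly_Theta (\<lambda>k. pivA (Q k)) (\<lambda>k i. hamming_weight (basA (Q k) i)) (sqrt_length Q) \<and>
     uniformly_Theta (\<lambda>k. pivAT (Q k)) (\<lambda>k j. hamming_weight (basAT (Q k) j)) (sqrt_length Q) \<and>
     uniformly_Theta (\<lambda>k. pivB (Q k)) (\<lambda>k h. hamming_weight (basB (Q k) h)) (sqrt_length Q) \<and>
     uniformly_Theta (\<lambda>k. pivBT (Q k)) (\<lambda>k l. hamming_weight (basBT (Q k) l)) (sqrt_length Q)"

definition same_sector_pairs :: "hgp \<Rightarrow> (lqubit \<times> lqubit) set" where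
  "same_sector_pairs Q =
     {(LeftQ i1 h1, LeftQ i2 h2) | i1 h1 i2 h2.
        i1 \<in> pivA Q \<and> h1 \<in> pivB Q \<and> i2 \<in> pivA Q \<and> h2 \<in> pivB Q \<and> (i1, h1) \<noteq> (i2, h2)}"

definition cross_sector_pairs :: "hgp \<Rightarrow> (lqubit \<times> lqubit) set" where
  "cross_sector_pairs Q =
     {(LeftQ i h, RightQ j l) | i h j l. i \<in> pivA Q \<and> h \<in> pivB Q \<and> j \<in> pivAT Q \<and> l \<in> pivBT Q}"

text \<open>A family \<open>C\<close> of circuits implements the logical CNOT from \<open>c\<close> to \<open>t\<close> for every code of the
  sequence and every pair \<open>(c, t)\<close> in \<open>pairs\<close>, with support size and depth of order
  \<open>\<Theta>(\<surd>n)\<close> uniformly in the pair.\<close>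

definition targeted_CNOT_family ::
  "(nat \<Rightarrow> hgp) \<Rightarrow> (hgp \<Rightarrow> (lqubit \<times> lqubit) set) \<Rightarrow> (nat \<Rightarrow> lqubit \<times> lqubit \<Rightarrow> circuit) \<Rightarrow> bool" where
  "targeted_CNOT_family Q pairs C \<longleftrightarrow>
     (\<forall>k. \<forall>(c, t)\<in>pairs (Q k).
        clifford_circuit (hgp_length (Q k)) (C k (c, t)) \<and> implements_CNOT (Q k) (C k (c, t)) c t) \<and>
     uniformly_Theta (\<lambda>k. pairs (Q k)) (\<lambda>k x. support_size (hgp_length (Q k)) (C k x)) (sqrt_length Q) \<and>
     uniformly_Theta (\<lambda>k. pairs (Q k)) (\<lambda>k x. depth (C k x)) (sqrt_length Q)"

end

theory Submission
  imports Defs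
begin

text \<open>Let \<open>u\<close> be the support of the logical \<open>X\<close> of the target \<open>t\<close> and \<open>w\<close> the support of the logical
  \<open>Z\<close> of the control \<open>c\<close>.  The unitary \<open>|x\<rangle> \<mapsto> |x + (w \<bullet> x) u\<rangle>\<close> multiplies an \<open>X\<close>-type operator by
  \<open>X\<^sub>t\<close> iff it anticommutes with \<open>Z\<^sub>c\<close>, and a \<open>Z\<close>-type operator by \<open>Z\<^sub>c\<close> iff it anticommutes with \<open>X\<^sub>t\<close>.
  Stabilizers commute with logical operators and the SLT bases are dual on their pivots, so this is
  exactly the logical CNOT.  For \<open>c \<noteq> t\<close> the sets \<open>supp u\<close> and \<open>supp w\<close> are disjoint, and the unitary
  is realised by fewer than \<open>|u| + 2|w|\<close> CNOT gates, each of which touches one fixed qubit of \<open>supp w\<close>,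
  so that the depth is the number of gates.\<close>

text \<open>These default rules rewrite addition and multiplication of bits to bit operations, which blocks
  the ring simplification rules.\<close>

declare add_bit_eq_xor [simp del] mult_bit_eq_and [simp del]

section \<open>Permutation and diagonal operators\<close>

definition basis_bits :: "nat \<Rightarrow> nat \<Rightarrow> bit vec" where
  "basis_bits n x = vec n (\<lambda>q. of_bool (bit x q))"

lemma basis_bits_carrier [simp]: "basis_bits n x \<in> carrier_vec n"
  and dim_basis_bits [simp]: "dim_vec (basis_bits n x) = n"
  and index_basis_bits [simp]: "q < n \<Longrightarrow> basis_bits n x $ q = of_bool (bit x q)"
  by (simp_all add: basis_bits_def)

lemma bit_nat_ge_False: "x < 2 ^ n \<Longrightarrow> n \<le> q \<Longrightarrow> \<not> bit x q" for x :: nat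
  by (metis bit_take_bit_iff leD take_bit_nat_eq_self_iff)

lemma basis_bits_inject:
  assumes "x < 2 ^ n" "y < 2 ^ n"
  shows "basis_bits n x = basis_bits n y \<longleftrightarrow> x = y"
proof
  assume eq: "basis_bits n x = basis_bits n y"
  have "bit x q = bit y q" for q
  proof (cases "q < n")
    case True
    then have "(of_bool (bit x q) :: bit) = of_bool (bit y q)"
      using eq by (metis index_basis_bits)
    then show ?thesis by (simp add: of_bool_eq_iff)
  qed (use assms in \<open>simp add: bit_nat_ge_False\<close>)
  then show "x = y" by (simp add: bit_eq_iff)
qed simp

lemma basis_bits_surj:
  assumes "v \<in> carrier_vec n"
  obtains x where "x < 2 ^ n" "basis_bits n x = v"
proof
  let ?bs = "map (\<lambda>q. v $ q = 1) [0..<n]"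
  show "horner_sum of_bool 2 ?bs < (2 ^ n :: nat)"
    using horner_sum_of_bool_2_less[of ?bs] by simp
  show "basis_bits n (horner_sum of_bool 2 ?bs) = v"
    using assms by (intro eq_vecI) (auto simp: bit_horner_sum_bit_iff)
qed

text \<open>The matrix of |v> \<mapsto> |F v>. The map acts on bit vectors instead of indices, so
  that linear algebra over F_2 applies to it directly; \<open>F\<close> may be any function, and
  values outside the space just give zero columns.\<close>

definition basis_map_op :: "nat \<Rightarrow> (bit vec \<Rightarrow> bit vec) \<Rightarrow> complex mat" where
  "basis_map_op n F =
     mat (2 ^ n) (2 ^ n) (\<lambda>(x, y). of_bool (basis_bits n x = F (basis_bits n y)))"

lemma basis_map_op_carrier [simp]: "basis_map_op n F \<in> carrier_mat (2 ^ n) (2 ^ n)"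
  and dim_basis_map_op [simp]: "dim_row (basis_map_op n F) = 2 ^ n" "dim_col (basis_map_op n F) = 2 ^ n"
  by (simp_all add: basis_map_op_def)

lemma basis_map_op_cong:
  "(\<And>v. v \<in> carrier_vec n \<Longrightarrow> F v = G v) \<Longrightarrow> basis_map_op n F = basis_map_op n G"
  by (simp add: basis_map_op_def)

lemma basis_map_op_id: "basis_map_op n (\<lambda>v. v) = 1\<^sub>m (2 ^ n)"
  by (intro eq_matI) (simp_all add: basis_map_op_def basis_bits_inject)

lemma basis_map_op_mult:
  assumes G: "\<And>v. v \<in> carrier_vec n \<Longrightarrow> G v \<in> carrier_vec n"
  shows "basis_map_op n F * basis_map_op n G = basis_map_op n (\<lambda>v. F (G v))"
proof (rule eq_matI)
  fix x y
  assume "x < dim_row (basis_map_op n (\<lambda>v. F (G v)))" "y < dim_col (basis_map_op n (\<lambda>v. F (G v)))"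
  then have xy: "x < 2 ^ n" "y < 2 ^ n" by simp_all
  \<comment> \<open>\<open>G\<close> stays inside the space, so the image of the column state has an
    index \<open>z\<close>; it is the only summand of the matrix product that survives.\<close>
  obtain z where z: "z < 2 ^ n" "basis_bits n z = G (basis_bits n y)"
    using basis_bits_surj[OF G[OF basis_bits_carrier]] .
  have "(basis_map_op n F * basis_map_op n G) $$ (x, y) =
      (\<Sum>z'<2 ^ n. of_bool (basis_bits n x = F (basis_bits n z')) * of_bool (z' = z))"
  proof -
    have "basis_bits n z' = G (basis_bits n y) \<longleftrightarrow> z' = z" if "z' < 2 ^ n" for z'
      using basis_bits_inject[OF that z(1)] by (simp add: z(2))
    then show ?thesis
      using xy unfolding basis_map_op_def lessThan_atLeast0
      by (simp add: scalar_prod_def del: sum_mult_of_bool_eq sum_of_bool_mult_eq sum_of_bool_eq)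
  qed
  also have "\<dots> = of_bool (basis_bits n x = F (G (basis_bits n y)))"
    using z by (subst sum.remove[of _ z]) (auto intro!: sum.neutral)
  finally show "(basis_map_op n F * basis_map_op n G) $$ (x, y) =
      basis_map_op n (\<lambda>v. F (G v)) $$ (x, y)"
    using xy by (simp add: basis_map_op_def)
qed simp_all

text \<open>The column of |v> has its only possible nonzero entry in row \<open>F v\<close>;
  multiplying by the diagonal on the right scales it by \<open>f v\<close>, on the left by
  \<open>g (F v)\<close>.\<close>

lemma basis_map_op_mult_diag:
  assumes "\<And>v. v \<in> carrier_vec n \<Longrightarrow> g (F v) = f v"
  shows "basis_map_op n F * mat_diag (2 ^ n) (\<lambda>x. f (basis_bits n x)) =
    mat_diag (2 ^ n) (\<lambda>x. g (basis_bits n x)) * basis_map_op n F"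
  using assms
  by (simp add: mat_diag_mult_left[OF basis_map_op_carrier] mat_diag_mult_right[OF basis_map_op_carrier])
    (auto simp: basis_map_op_def)

lemma index_mat_adjoint:
  "i < dim_col A \<Longrightarrow> j < dim_row A \<Longrightarrow> mat_adjoint A $$ (i, j) = conjugate (A $$ (j, i))"
  by (simp add: mat_adjoint_def mat_of_rows_index)

text \<open>The entries are 0 and 1, so the adjoint is the transpose, and for an involution the
  relation \<open>v = F v'\<close> is symmetric.\<close>

lemma mat_adjoint_basis_map_op_involution:
  assumes "\<And>v. v \<in> carrier_vec n \<Longrightarrow> F (F v) = v"
  shows "mat_adjoint (basis_map_op n F) = basis_map_op n F"
proof (rule eq_matI)
  fix x y
  assume "x < dim_row (basis_map_op n F)" "y < dim_col (basis_map_op n F)"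
  moreover have "basis_bits n y = F (basis_bits n x) \<longleftrightarrow> basis_bits n x = F (basis_bits n y)"
    using assms by (metis basis_bits_carrier)
  ultimately show "mat_adjoint (basis_map_op n F) $$ (x, y) = basis_map_op n F $$ (x, y)"
    by (simp add: index_mat_adjoint) (simp add: basis_map_op_def)
qed (simp_all add: mat_adjoint_def)

text \<open>The operator is its own adjoint and its own inverse, so a conjugation can be read off
  from an intertwining relation, without evaluating a triple product.\<close>

lemma conj_by_basis_map_op_involution:
  assumes F: "\<And>v. v \<in> carrier_vec n \<Longrightarrow> F v \<in> carrier_vec n"
    and inv: "\<And>v. v \<in> carrier_vec n \<Longrightarrow> F (F v) = v"
    and "P' \<in> carrier_mat (2 ^ n) (2 ^ n)"
    and "basis_map_op n F * P = P' * basis_map_op n F"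
  shows "conj_by (basis_map_op n F) P = P'"
proof -
  have "basis_map_op n F * basis_map_op n F = 1\<^sub>m (2 ^ n)"
    using inv by (simp add: basis_map_op_mult F basis_map_op_id[symmetric] cong: basis_map_op_cong)
  then show ?thesis
    using assms(3)
    by (simp add: conj_by_def mat_adjoint_basis_map_op_involution inv assms(4)
        assoc_mult_mat[of _ "2 ^ n" "2 ^ n" _ "2 ^ n" _ "2 ^ n"])
qed

section \<open>Pauli operators as translations and sign operators\<close>

lemma prod_of_bool: "finite A \<Longrightarrow> (\<Prod>q\<in>A. of_bool (P q)) = (of_bool (\<forall>q\<in>A. P q) :: complex)"
  by (induction A rule: finite_induct) auto

text \<open>Each tensor factor is the indicator of one coordinate of the equation
  \<open>x = y + v\<close>, and a product of indicators is the indicator of the conjunction.\<close>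

lemma X_type_eq:
  assumes v: "v \<in> carrier_vec n"
  shows "X_type v = basis_map_op n (\<lambda>x. x + v)"
proof -
  have "(if v $ q = 1 then pauli_X else 1\<^sub>m 2) $$ (of_bool a, of_bool b) =
      of_bool ((of_bool a :: bit) = of_bool b + v $ q)" for q a b
    by (cases "v $ q"; cases a; cases b) (simp_all add: mat_of_rows_list_def)
  then show ?thesis
    using v by (intro eq_matI) (auto simp: X_type_def tensor_op_def basis_map_op_def prod_of_bool vec_eq_iff)
qed

text \<open>The nontrivial character of the additive group of F_2; it turns the sum in a scalar
  product into the product over tensor factors.\<close>

definition bit_sign :: "bit \<Rightarrow> complex" where
  "bit_sign b = (if b = 0 then 1 else - 1)"

lemma bit_sign_add: "bit_sign (a + b) = bit_sign a * bit_sign b"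
  by (cases a; cases b) (simp_all add: bit_sign_def)

lemma bit_sign_sum: "finite A \<Longrightarrow> bit_sign (sum f A) = (\<Prod>q\<in>A. bit_sign (f q))"
proof (induction A rule: finite_induct)
  case (insert q A)
  then show ?case by (simp add: bit_sign_add)
qed (simp add: bit_sign_def)

lemma Z_type_eq:
  assumes v: "v \<in> carrier_vec n"
  shows "Z_type v = mat_diag (2 ^ n) (\<lambda>x. bit_sign (v \<bullet> basis_bits n x))"
proof -
  have entry: "(if v $ q = 1 then pauli_Z else 1\<^sub>m 2) $$ (of_bool a, of_bool b) =
      of_bool (a = b) * bit_sign (v $ q * of_bool b)" for q a b
    by (cases "v $ q"; cases a; cases b) (simp_all add: mat_of_rows_list_def bit_sign_def)
  show ?thesis
  proof (rule eq_matI)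
    fix x y
    assume "x < dim_row (mat_diag (2 ^ n) (\<lambda>x. bit_sign (v \<bullet> basis_bits n x)))"
      "y < dim_col (mat_diag (2 ^ n) (\<lambda>x. bit_sign (v \<bullet> basis_bits n x)))"
    then have xy: "x < 2 ^ n" "y < 2 ^ n" by (simp_all add: mat_diag_def)
    \<comment> \<open>The indicators of equal digits multiply to the indicator of the
      diagonal.\<close>
    have eq: "(\<forall>q\<in>{..<n}. bit x q = bit y q) \<longleftrightarrow> x = y"
      using basis_bits_inject[OF xy] by (auto simp: vec_eq_iff of_bool_eq_iff)
    have "v \<bullet> basis_bits n y = (\<Sum>q<n. v $ q * of_bool (bit y q))"
      by (simp add: scalar_prod_def flip: lessThan_atLeast0)
    then have "bit_sign (v \<bullet> basis_bits n y) = (\<Prod>q<n. bit_sign (v $ q * of_bool (bit y q)))"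
      by (simp only: bit_sign_sum finite_lessThan)
    moreover have "Z_type v $$ (x, y) =
        (\<Prod>q<n. (if v $ q = 1 then pauli_Z else 1\<^sub>m 2) $$ (of_bool (bit x q), of_bool (bit y q)))"
      using v xy by (simp add: Z_type_def tensor_op_def)
    then have "Z_type v $$ (x, y) =
        (\<Prod>q<n. of_bool (bit x q = bit y q)) * (\<Prod>q<n. bit_sign (v $ q * of_bool (bit y q)))"
      unfolding entry prod.distrib .
    ultimately show "Z_type v $$ (x, y) =
        mat_diag (2 ^ n) (\<lambda>x. bit_sign (v \<bullet> basis_bits n x)) $$ (x, y)"
      using xy by (simp add: prod_of_bool eq mat_diag_def)
  qed (use v in \<open>simp_all add: Z_type_def tensor_op_def mat_diag_def\<close>)
qed

section \<open>Transvections and their CNOT circuits\<close>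

text \<open>This is a transvection in the usual sense when \<open>w \<bullet> u = 0\<close>; for
  \<open>w \<bullet> u = 1\<close> it is a projection. CNOT from qubit q to qubit r is the case
  where \<open>u\<close> and \<open>w\<close> are the unit vectors at r and q.\<close>

definition transvection :: "bit vec \<Rightarrow> bit vec \<Rightarrow> bit vec \<Rightarrow> bit vec" where
  "transvection u w x = x + (w \<bullet> x) \<cdot>\<^sub>v u"

lemma transvection_carrier [simp]:
  "u \<in> carrier_vec n \<Longrightarrow> x \<in> carrier_vec n \<Longrightarrow> transvection u w x \<in> carrier_vec n"
  by (simp add: transvection_def)

lemma scalar_prod_transvection:
  assumes "u \<in> carrier_vec n" "v \<in> carrier_vec n" "x \<in> carrier_vec n"
  shows "v \<bullet> transvection u w x = v \<bullet> x + (w \<bullet> x) * (v \<bullet> u)"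
  using assms by (simp add: transvection_def scalar_prod_add_distrib[of _ n])

lemma bit_add_self: "a + a = 0" for a :: bit
  by (cases a) simp_all

lemma bit_add_self_left: "a + (a + b) = b" for a b :: bit
  by (cases a; cases b) simp_all

text \<open>The form \<open>w'\<close> does not see a shift along \<open>u\<close>, so it reads the
  same bit before and after the first map, and the two shifts add up.\<close>

lemma transvection_comp_same_direction:
  assumes "u \<in> carrier_vec n" "w \<in> carrier_vec n" "w' \<in> carrier_vec n" "x \<in> carrier_vec n"
    and "w' \<bullet> u = 0"
  shows "transvection u w' (transvection u w x) = transvection u (w' + w) x"
proof -
  have "w' \<bullet> transvection u w x = w' \<bullet> x"
    using assms by (simp add: scalar_prod_transvection[of _ n])
  then show ?thesis
    using assms
    by (intro eq_vecI) (auto simp: transvection_def add_scalar_prod_distrib[of _ n] algebra_simps)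
qed

lemma transvection_comp_same_form:
  assumes "u \<in> carrier_vec n" "u' \<in> carrier_vec n" "w \<in> carrier_vec n" "x \<in> carrier_vec n"
    and "w \<bullet> u = 0"
  shows "transvection u' w (transvection u w x) = transvection (u' + u) w x"
proof -
  have "w \<bullet> transvection u w x = w \<bullet> x"
    using assms by (simp add: scalar_prod_transvection[of _ n])
  then show ?thesis
    using assms by (intro eq_vecI) (auto simp: transvection_def algebra_simps)
qed

lemma transvection_involution:
  assumes "u \<in> carrier_vec n" "w \<in> carrier_vec n" "x \<in> carrier_vec n" "w \<bullet> u = 0"
  shows "transvection u w (transvection u w x) = x"
proof -
  have "w \<bullet> transvection u w x = w \<bullet> x"
    using assms by (simp add: scalar_prod_transvection[of _ n])
  then show ?thesis
    using assms by (intro eq_vecI) (auto simp: transvection_def add.assoc bit_add_self)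
qed

text \<open>Compute, use, uncompute: after the first map \<open>f\<close> reads
  \<open>f \<bullet> x + w \<bullet> x\<close>, since \<open>f \<bullet> e = 1\<close>. Shifts along
  \<open>e\<close> and \<open>u\<close> leave \<open>w \<bullet> x\<close> unchanged, so the outer
  maps shift by the same multiple of \<open>e\<close>, which cancels over F_2.\<close>

lemma transvection_conjugate:
  assumes "e \<in> carrier_vec n" "u \<in> carrier_vec n" "f \<in> carrier_vec n" "w \<in> carrier_vec n"
    "x \<in> carrier_vec n"
    and "w \<bullet> e = 0" "w \<bullet> u = 0" "f \<bullet> e = 1"
  shows "transvection e w (transvection u f (transvection e w x)) = transvection u (w + f) x"
proof -
  have "w \<bullet> transvection u f (transvection e w x) = w \<bullet> x"
    and "f \<bullet> transvection e w x = f \<bullet> x + w \<bullet> x"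
    using assms by (simp_all add: scalar_prod_transvection[of _ n])
  then show ?thesis
    using assms
    by (intro eq_vecI)
      (auto simp: transvection_def add_scalar_prod_distrib[of _ n] algebra_simps bit_add_self
        bit_add_self_left)
qed

section \<open>Unitaries of CNOT circuits\<close>

lemma local_op_CNOT:
  assumes "q < n" "r < n" "q \<noteq> r"
  shows "local_op n [q, r] (gate_matrix (GateCNOT q r)) =
    basis_map_op n (transvection (unit_vec n r) (unit_vec n q))"
proof -
  \<comment> \<open>\<open>sub_index\<close> makes the control the more significant digit, so the
    exchanged rows 2 and 3 are those with the control set. The four digits give sixteen
    cases.\<close>
  have entry: "gate_matrix (GateCNOT q r) $$ (sub_index [q, r] x, sub_index [q, r] y) =
      of_bool (bit x q = bit y q \<and> (bit x r \<longleftrightarrow> bit y r \<noteq> bit y q))" for x y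
    by (cases "bit x q"; cases "bit x r"; cases "bit y q"; cases "bit y r")
      (simp_all add: sub_index_def mat_of_rows_list_def)
  have eq: "basis_bits n x = transvection (unit_vec n r) (unit_vec n q) (basis_bits n y) \<longleftrightarrow>
      (\<forall>p<n. bit x p \<longleftrightarrow> (bit y p \<noteq> (p = r \<and> bit y q)))" for x y
  proof -
    have "((of_bool (bit x p) :: bit) = of_bool (bit y p) + of_bool (bit y q) * unit_vec n r $ p) \<longleftrightarrow>
        (bit x p \<longleftrightarrow> (bit y p \<noteq> (p = r \<and> bit y q)))" if "p < n" for p
      using that assms by (cases "bit x p"; cases "bit y p"; cases "bit y q") auto
    then show ?thesis
      using assms by (simp add: vec_eq_iff transvection_def)
  qed
  have "(if \<forall>p<n. p \<notin> set [q, r] \<longrightarrow> bit x p = bit y p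
       then gate_matrix (GateCNOT q r) $$ (sub_index [q, r] x, sub_index [q, r] y) else 0) =
      of_bool (basis_bits n x = transvection (unit_vec n r) (unit_vec n q) (basis_bits n y))" for x y
    unfolding entry eq using assms by (auto simp del: of_bool_eq_iff)
  then show ?thesis
    unfolding local_op_def basis_map_op_def by (intro cong_mat refl) (simp only: prod.case)
qed

lemma circuit_unitary_append:
  "circuit_unitary n (C @ D) = circuit_unitary n D * circuit_unitary n C"
proof -
  have carrier: "local_op n (gate_qubits g) (gate_matrix g) \<in> carrier_mat (2 ^ n) (2 ^ n)" for g
    by (simp add: local_op_def)
  \<comment> \<open>The fold over \<open>D\<close> starts from the unitary of \<open>C\<close>,
    hence an arbitrary initial matrix \<open>V\<close>; the carrier is included since associativity
    requires it.\<close>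
  have "foldl (\<lambda>U g. local_op n (gate_qubits g) (gate_matrix g) * U) V D =
      circuit_unitary n D * V \<and> circuit_unitary n D \<in> carrier_mat (2 ^ n) (2 ^ n)"
    if "V \<in> carrier_mat (2 ^ n) (2 ^ n)" for V
    using that
  proof (induction D rule: rev_induct)
    case (snoc g D)
    then show ?case
      using carrier[of g] by (auto simp: circuit_unitary_def)
  qed (simp add: circuit_unitary_def)
  moreover have "circuit_unitary n C \<in> carrier_mat (2 ^ n) (2 ^ n)"
    by (induction C rule: rev_induct)
      (use carrier in \<open>auto simp: circuit_unitary_def intro!: mult_carrier_mat\<close>)
  moreover have "circuit_unitary n (C @ D) =
      foldl (\<lambda>U g. local_op n (gate_qubits g) (gate_matrix g) * U) (circuit_unitary n C) D"
    by (simp add: circuit_unitary_def)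
  ultimately show ?thesis by simp
qed

definition indicator_vec :: "nat \<Rightarrow> nat set \<Rightarrow> bit vec" where
  "indicator_vec n A = vec n (\<lambda>q. of_bool (q \<in> A))"

lemma indicator_vec_carrier [simp]: "indicator_vec n A \<in> carrier_vec n"
  and dim_indicator_vec [simp]: "dim_vec (indicator_vec n A) = n"
  and index_indicator_vec [simp]: "q < n \<Longrightarrow> indicator_vec n A $ q = of_bool (q \<in> A)"
  by (simp_all add: indicator_vec_def)

lemma indicator_vec_insert:
  "q \<notin> A \<Longrightarrow> indicator_vec n (insert q A) = indicator_vec n A + unit_vec n q"
  by (intro eq_vecI) (auto simp: indicator_vec_def unit_vec_def)

lemma circuit_unitary_Cons_CNOT:
  assumes "q < n" "r < n" "q \<noteq> r"
  shows "circuit_unitary n (GateCNOT q r # C) =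
    circuit_unitary n C * basis_map_op n (transvection (unit_vec n r) (unit_vec n q))"
proof -
  have "circuit_unitary n [GateCNOT q r] =
      basis_map_op n (transvection (unit_vec n r) (unit_vec n q))"
    using local_op_CNOT[OF assms] by (simp add: circuit_unitary_def)
  then show ?thesis
    using circuit_unitary_append[of n "[GateCNOT q r]" C] by simp
qed

lemma circuit_unitary_Nil: "circuit_unitary n [] = basis_map_op n (\<lambda>v. v)"
  by (simp add: circuit_unitary_def basis_map_op_id)

text \<open>All gates share the target \<open>p\<close>, which is never a control; hence no gate
  alters what a later one reads, and the forms add up.\<close>

lemma circuit_unitary_fan_in:
  assumes "p < n" "set qs \<subseteq> {..<n}" "p \<notin> set qs" "distinct qs"
  shows "circuit_unitary n (map (\<lambda>q. GateCNOT q p) qs) =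
    basis_map_op n (transvection (unit_vec n p) (indicator_vec n (set qs)))"
  using assms
proof (induction qs)
  case Nil
  have "transvection (unit_vec n p) (indicator_vec n {}) v = v" if "v \<in> carrier_vec n" for v
    using that by (intro eq_vecI) (simp_all add: transvection_def indicator_vec_def scalar_prod_def)
  then show ?case
    by (simp add: circuit_unitary_Nil cong: basis_map_op_cong)
next
  case (Cons q qs)
  have "indicator_vec n (set qs) \<bullet> unit_vec n p = 0"
    using Cons.prems by simp
  then show ?case
    using Cons
    by (auto simp: circuit_unitary_Cons_CNOT basis_map_op_mult transvection_comp_same_direction[of _ n]
        indicator_vec_insert intro!: basis_map_op_cong)
qed

text \<open>Dual to the fan-in: the common control \<open>p\<close> is never a target, so every gate
  reads the same bit and the directions add up.\<close>

lemma circuit_unitary_fan_out: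
  assumes "p < n" "set qs \<subseteq> {..<n}" "p \<notin> set qs" "distinct qs"
  shows "circuit_unitary n (map (GateCNOT p) qs) =
    basis_map_op n (transvection (indicator_vec n (set qs)) (unit_vec n p))"
  using assms
proof (induction qs)
  case Nil
  have "transvection (indicator_vec n {}) (unit_vec n p) v = v" if "v \<in> carrier_vec n" for v
    using that by (intro eq_vecI) (simp_all add: transvection_def indicator_vec_def)
  then show ?case
    by (simp add: circuit_unitary_Nil cong: basis_map_op_cong)
next
  case (Cons q qs)
  have "unit_vec n p \<bullet> unit_vec n q = (0 :: bit)"
    using Cons.prems by simp
  then show ?case
    using Cons
    by (auto simp: circuit_unitary_Cons_CNOT basis_map_op_mult transvection_comp_same_form[of _ n]
        indicator_vec_insert intro!: basis_map_op_cong)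
qed

text \<open>The parity of the qubits in the support of \<open>w\<close> is accumulated in qubit \<open>p\<close>, added from there to
  the qubits in the support of \<open>u\<close>, and uncomputed.\<close>

definition parity_cnot :: "nat \<Rightarrow> bit vec \<Rightarrow> bit vec \<Rightarrow> circuit" where
  "parity_cnot p u w =
     (let fan_in = map (\<lambda>q. GateCNOT q p) (filter (\<lambda>q. w $ q = 1 \<and> q \<noteq> p) [0..<dim_vec w])
      in fan_in @ map (GateCNOT p) (filter (\<lambda>q. u $ q = 1) [0..<dim_vec u]) @ fan_in)"

text \<open>\<open>u $ p = 0\<close> keeps control and target of the fan-out gates distinct; in the
  fan-in the filter \<open>q \<noteq> p\<close> does this.\<close>

lemma clifford_circuit_parity_cnot:
  assumes "u \<in> carrier_vec n" "w \<in> carrier_vec n" "p < n" "u $ p = 0"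
  shows "clifford_circuit n (parity_cnot p u w)"
  using assms by (auto simp: clifford_circuit_def parity_cnot_def Let_def)

lemma circuit_unitary_parity_cnot:
  assumes u: "u \<in> carrier_vec n" and w: "w \<in> carrier_vec n" and p: "p < n" "w $ p = 1"
    and disj: "\<And>q. q < n \<Longrightarrow> u $ q = 0 \<or> w $ q = 0"
  shows "circuit_unitary n (parity_cnot p u w) = basis_map_op n (transvection u w)"
proof -
  \<comment> \<open>Qubit \<open>p\<close> already holds its own bit of the parity, so only the
    remaining support of \<open>w\<close> is fanned in, and \<open>unit_vec n p\<close> supplies the
    missing summand.\<close>
  define A where "A = {q. q < n \<and> w $ q = 1 \<and> q \<noteq> p}"
  define B where "B = {q. q < n \<and> u $ q = 1}"
  have "u $ p = 0" using disj[OF p(1)] p(2) by simp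
  have u_eq: "indicator_vec n B = u"
    using u by (intro eq_vecI) (auto simp: B_def)
  have w_eq: "indicator_vec n A + unit_vec n p = w"
    using w p by (intro eq_vecI) (auto simp: A_def)
  have "indicator_vec n A \<bullet> unit_vec n p = 0"
    using p by (simp add: A_def)
  moreover have "indicator_vec n A \<bullet> u = 0"
    using u disj by (fastforce simp: A_def scalar_prod_def intro: sum.neutral)
  \<comment> \<open>Both \<open>e\<close> and \<open>f\<close> are the unit vector at
    \<open>p\<close>: this qubit is the target of the fan-in and the control of the fan-out.\<close>
  ultimately have conj: "transvection (unit_vec n p) (indicator_vec n A)
      (transvection u (unit_vec n p) (transvection (unit_vec n p) (indicator_vec n A) x)) =
      transvection u w x" if "x \<in> carrier_vec n" for x
    using transvection_conjugate[of "unit_vec n p" n u "unit_vec n p" "indicator_vec n A" x]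
      that u p by (simp add: w_eq)
  have A_set: "A = set (filter (\<lambda>q. w $ q = 1 \<and> q \<noteq> p) [0..<dim_vec w])"
    using w by (auto simp: A_def)
  have B_set: "B = set (filter (\<lambda>q. u $ q = 1) [0..<dim_vec u])"
    using u by (auto simp: B_def)
  have fan_in: "circuit_unitary n (map (\<lambda>q. GateCNOT q p)
      (filter (\<lambda>q. w $ q = 1 \<and> q \<noteq> p) [0..<dim_vec w])) =
      basis_map_op n (transvection (unit_vec n p) (indicator_vec n A))"
    unfolding A_set by (rule circuit_unitary_fan_in) (use w p in auto)
  have fan_out: "circuit_unitary n (map (GateCNOT p)
      (filter (\<lambda>q. u $ q = 1) [0..<dim_vec u])) =
      basis_map_op n (transvection (indicator_vec n B) (unit_vec n p))"
    unfolding B_set by (rule circuit_unitary_fan_out) (use u p \<open>u $ p = 0\<close> in auto)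
  show ?thesis
    unfolding parity_cnot_def Let_def circuit_unitary_append fan_in fan_out u_eq
    using u conj by (auto simp: basis_map_op_mult intro!: basis_map_op_cong)
qed

section \<open>Conjugation of Pauli operators by transvections\<close>

lemma X_type_mult:
  assumes "u \<in> carrier_vec n" "v \<in> carrier_vec n"
  shows "X_type u * X_type v = X_type (u + v)"
proof -
  have "x + v + u = x + (u + v)" if "x \<in> carrier_vec n" for x
    using that assms by (intro eq_vecI) (auto simp: ac_simps)
  then show ?thesis
    using assms by (auto simp: X_type_eq[of _ n] basis_map_op_mult intro!: basis_map_op_cong)
qed

lemma Z_type_mult:
  assumes "u \<in> carrier_vec n" "v \<in> carrier_vec n"
  shows "Z_type u * Z_type v = Z_type (u + v)"
  using assms by (simp add: Z_type_eq[of _ n] add_scalar_prod_distrib[of _ n] bit_sign_add)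

text \<open>A linear map carries translation by \<open>v\<close> to translation by the image of
  \<open>v\<close>.\<close>

lemma conj_by_transvection_X_type:
  assumes "u \<in> carrier_vec n" "w \<in> carrier_vec n" "w \<bullet> u = 0" "v \<in> carrier_vec n"
  shows "conj_by (basis_map_op n (transvection u w)) (X_type v) = X_type (transvection u w v)"
proof (rule conj_by_basis_map_op_involution)
  have "transvection u w (x + v) = transvection u w x + transvection u w v"
    if "x \<in> carrier_vec n" for x
    using that assms
    by (intro eq_vecI) (auto simp: transvection_def scalar_prod_add_distrib[of _ n] algebra_simps)
  then show "basis_map_op n (transvection u w) * X_type v =
      X_type (transvection u w v) * basis_map_op n (transvection u w)"
    using assms by (auto simp: X_type_eq[of _ n] basis_map_op_mult intro!: basis_map_op_cong)
qed (use assms in \<open>simp_all add: transvection_involution[of _ n] X_type_eq[of _ n]\<close>)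

text \<open>Exchanging \<open>u\<close> and \<open>w\<close> gives the contragredient map: the pair
  preserves the scalar product, as the two cross terms
  \<open>(w \<bullet> x) * (v \<bullet> u)\<close> cancel over F_2. So the sign of the new operator
  at the image state is the old sign.\<close>

lemma conj_by_transvection_Z_type:
  assumes "u \<in> carrier_vec n" "w \<in> carrier_vec n" "w \<bullet> u = 0" "v \<in> carrier_vec n"
  shows "conj_by (basis_map_op n (transvection u w)) (Z_type v) = Z_type (transvection w u v)"
proof (rule conj_by_basis_map_op_involution)
  have "transvection w u v \<bullet> transvection u w x = v \<bullet> x" if "x \<in> carrier_vec n" for x
  proof -
    have "transvection w u v \<bullet> y = v \<bullet> y + (u \<bullet> v) * (w \<bullet> y)" if "y \<in> carrier_vec n" for y
      using that assms by (simp add: transvection_def add_scalar_prod_distrib[of _ n])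
    then show ?thesis
      using that assms comm_scalar_prod[of u n v]
      by (simp add: scalar_prod_transvection[of _ n] mult.commute add.assoc bit_add_self)
  qed
  then show "basis_map_op n (transvection u w) * Z_type v =
      Z_type (transvection w u v) * basis_map_op n (transvection u w)"
    using assms
    by (simp add: Z_type_eq[of _ n])
      (rule basis_map_op_mult_diag[of n "\<lambda>x. bit_sign (transvection w u v \<bullet> x)"
          "transvection u w" "\<lambda>x. bit_sign (v \<bullet> x)"], simp)
qed (use assms in \<open>simp_all add: transvection_involution[of _ n] Z_type_eq[of _ n]\<close>)

section \<open>Size of the circuits\<close>

text \<open>Digit \<open>q\<close> is neither written, because \<open>u $ q = 0\<close>, nor read,
  because \<open>w $ q = 0\<close>; clearing it in both indices changes an entry only if the two
  digits differed.\<close>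

lemma transvection_acts_as_identity_on:
  assumes u: "u \<in> carrier_vec n" and w: "w \<in> carrier_vec n" and q: "q < n" "u $ q = 0" "w $ q = 0"
  shows "acts_as_identity_on n (basis_map_op n (transvection u w)) q"
  unfolding acts_as_identity_on_def
\<comment> \<open>The witness for \<open>V\<close> is the matrix itself, evaluated at the indices
  with digit \<open>q\<close> cleared.\<close>
proof (intro exI allI impI)
  fix x y :: nat
  assume xy: "x < 2 ^ n" "y < 2 ^ n"
  let ?U = "basis_map_op n (transvection u w)"
  have less: "unset_bit q x < 2 ^ n" "unset_bit q y < 2 ^ n"
    using xy q(1)
    by (simp_all add: take_bit_unset_bit_eq flip: take_bit_nat_eq_self_iff)
  define c where "c = w \<bullet> basis_bits n y"
  have c_unset: "w \<bullet> basis_bits n (unset_bit q y) = c"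
    unfolding scalar_prod_def c_def
    by (rule sum.cong) (use q in \<open>auto simp: bit_unset_bit_iff\<close>)
  have eq_iff: "basis_bits n x' = basis_bits n y' + c \<cdot>\<^sub>v u \<longleftrightarrow>
      (\<forall>p<n. (of_bool (bit x' p) :: bit) = of_bool (bit y' p) + c * u $ p)" for x' y'
    using u by (simp add: vec_eq_iff)
  have "(of_bool (bit (unset_bit q x) p) :: bit) = of_bool (bit (unset_bit q y) p) + c * u $ p \<longleftrightarrow>
      p = q \<or> (of_bool (bit x p) :: bit) = of_bool (bit y p) + c * u $ p" for p
    using q by (cases "p = q") (simp_all add: bit_unset_bit_iff)
  moreover have "(of_bool (bit x q) :: bit) = of_bool (bit y q) + c * u $ q \<longleftrightarrow> bit x q = bit y q"
    using q by (simp add: of_bool_eq_iff)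
  ultimately have "basis_bits n x = transvection u w (basis_bits n y) \<longleftrightarrow> bit x q = bit y q \<and>
      basis_bits n (unset_bit q x) = transvection u w (basis_bits n (unset_bit q y))"
    unfolding transvection_def c_unset c_def[symmetric] eq_iff using q(1) by metis
  then show "?U $$ (x, y) =
      (if bit x q = bit y q then (\<lambda>x y. ?U $$ (x, y)) (unset_bit q x) (unset_bit q y) else 0)"
    using xy less by (auto simp: basis_map_op_def)
qed

text \<open>The basis state of the unit vector at \<open>p\<close> has odd parity under
  \<open>w\<close>, so the map flips its digit \<open>q\<close>; this is a nonzero entry between
  indices that differ at \<open>q\<close>.\<close>

lemma transvection_not_acts_as_identity_on:
  assumes u: "u \<in> carrier_vec n" and w: "w \<in> carrier_vec n" and q: "q < n" "u $ q = 1"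
    and p: "p < n" "w $ p = 1"
  shows "\<not> acts_as_identity_on n (basis_map_op n (transvection u w)) q"
proof
  let ?U = "basis_map_op n (transvection u w)"
  assume "acts_as_identity_on n ?U q"
  then obtain V where V: "\<And>x y. x < 2 ^ n \<Longrightarrow> y < 2 ^ n \<Longrightarrow>
      ?U $$ (x, y) = (if bit x q = bit y q then V (unset_bit q x) (unset_bit q y) else 0)"
    unfolding acts_as_identity_on_def by blast
  obtain y where y: "y < 2 ^ n" "basis_bits n y = unit_vec n p"
    using basis_bits_surj[of "unit_vec n p" n] by auto
  obtain x where x: "x < 2 ^ n" "basis_bits n x = transvection u w (unit_vec n p)"
    using basis_bits_surj[of "transvection u w (unit_vec n p)" n] u by auto
  have "basis_bits n x $ q = basis_bits n y $ q + 1"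
    using x y u w p q by (simp add: transvection_def)
  then have "bit x q \<noteq> bit y q"
    using q by auto
  moreover have "?U $$ (x, y) = 1"
    using x y by (simp add: basis_map_op_def)
  ultimately show False
    using V[OF x(1) y(1)] by simp
qed

text \<open>The lower bound counts only the qubits that get flipped. This is enough for the order of
  growth, since \<open>u\<close> alone already has weight of order sqrt n.\<close>

lemma support_size_transvection:
  assumes u: "u \<in> carrier_vec n" and w: "w \<in> carrier_vec n" and p: "p < n" "w $ p = 1"
    and U: "circuit_unitary n C = basis_map_op n (transvection u w)"
  shows "hamming_weight u \<le> support_size n C"
    and "support_size n C \<le> hamming_weight u + hamming_weight w"
proof -
  have sub: "circuit_support n C \<subseteq> {q. q < n \<and> u $ q = 1} \<union> {q. q < n \<and> w $ q = 1}"
    using transvection_acts_as_identity_on[OF u w] by (fastforce simp: circuit_support_def U)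
  have super: "{q. q < n \<and> u $ q = 1} \<subseteq> circuit_support n C"
    using transvection_not_acts_as_identity_on[OF u w _ _ p] by (auto simp: circuit_support_def U)
  show "hamming_weight u \<le> support_size n C"
    using u card_mono[OF finite_subset[OF sub] super] by (simp add: hamming_weight_def support_size_def)
  have "support_size n C \<le> card ({q. q < n \<and> u $ q = 1} \<union> {q. q < n \<and> w $ q = 1})"
    unfolding support_size_def by (intro card_mono sub) simp
  also have "\<dots> \<le> hamming_weight u + hamming_weight w"
    using u w card_Un_le by (auto simp: hamming_weight_def)
  finally show "support_size n C \<le> hamming_weight u + hamming_weight w" .
qed

text \<open>Any two gates overlap in \<open>p\<close>, so layers strictly increase along the circuit
  and each layer holds one gate at most.\<close>

lemma depth_eq_length:
  assumes "\<And>g. g \<in> set C \<Longrightarrow> p \<in> set (gate_qubits g)"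
  shows "depth C = length C"
  unfolding depth_def
proof (rule Least_equality)
  show "\<exists>layer. layering C (length C) layer"
    by (auto simp: layering_def intro!: exI[of _ "\<lambda>i. i"])
next
  fix d
  assume "\<exists>layer. layering C d layer"
  then obtain layer where layer: "layering C d layer" ..
  have mono: "layer i < layer j" if "i < j" "j < length C" for i j
  proof -
    have "p \<in> set (gate_qubits (C ! i)) \<inter> set (gate_qubits (C ! j))"
      using that assms by simp
    then show ?thesis
      using layer that unfolding layering_def by blast
  qed
  have "inj_on layer {..<length C}"
    by (rule linorder_inj_onI) (use mono in \<open>force+\<close>)
  moreover have "layer ` {..<length C} \<subseteq> {..<d}"
    using layer by (auto simp: layering_def)
  ultimately show "length C \<le> d"
    using card_inj_on_le[of layer "{..<length C}" "{..<d}"] by simp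
qed

lemma length_filter_hamming_weight:
  "length (filter (\<lambda>q. u $ q = 1) [0..<dim_vec u]) = hamming_weight u"
  by (simp add: length_filter_conv_card hamming_weight_def cong: conj_cong)

lemma depth_parity_cnot:
  shows "hamming_weight u \<le> depth (parity_cnot p u w)"
    and "depth (parity_cnot p u w) \<le> hamming_weight u + 2 * hamming_weight w"
proof -
  have "depth (parity_cnot p u w) = length (parity_cnot p u w)"
    by (rule depth_eq_length[of _ p]) (auto simp: parity_cnot_def Let_def)
  moreover have "length (filter (\<lambda>q. w $ q = 1 \<and> q \<noteq> p) [0..<dim_vec w]) \<le> hamming_weight w"
    using length_filter_le[of "\<lambda>q. q \<noteq> p" "filter (\<lambda>q. w $ q = 1) [0..<dim_vec w]"]
    by (simp add: length_filter_hamming_weight conj_commute)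
  ultimately show "hamming_weight u \<le> depth (parity_cnot p u w)"
    and "depth (parity_cnot p u w) \<le> hamming_weight u + 2 * hamming_weight w"
    by (simp_all add: parity_cnot_def Let_def length_filter_hamming_weight)
qed

section \<open>Kronecker products and Hamming weights\<close>

text \<open>The range splits into \<open>a\<close> blocks of length \<open>b\<close>, on which
  \<open>k div b\<close> is constant while \<open>k mod b\<close> runs through all residues. Scalar
  products and weights of Kronecker products both factor by this.\<close>

lemma sum_div_mod:
  fixes f g :: "nat \<Rightarrow> 'a :: comm_semiring_0"
  shows "(\<Sum>k<a * b. f (k div b) * g (k mod b)) = sum f {..<a} * sum g {..<b}"
proof -
  have inner: "(\<Sum>k = m * b..<m * b + b. f (k div b) * g (k mod b)) = (\<Sum>j<b. f m * g j)" for m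
  proof -
    have "(\<Sum>k = m * b..<m * b + b. f (k div b) * g (k mod b)) =
        (\<Sum>j = 0..<b. f ((j + m * b) div b) * g ((j + m * b) mod b))"
      using sum.shift_bounds_nat_ivl[of "\<lambda>k. f (k div b) * g (k mod b)" 0 "m * b" b]
      by (simp add: add.commute)
    then show ?thesis
      by (simp add: lessThan_atLeast0)
  qed
  have "(\<Sum>k<a * b. f (k div b) * g (k mod b)) =
      (\<Sum>m<a. \<Sum>k = m * b..<m * b + b. f (k div b) * g (k mod b))"
    by (simp add: sum.nat_group)
  also have "\<dots> = (\<Sum>m<a. \<Sum>j<b. f m * g j)"
    by (intro sum.cong refl inner)
  finally show ?thesis
    by (simp add: sum_product)
qed

lemma dim_kron_vec [simp]: "dim_vec (kron_vec v w) = dim_vec v * dim_vec w"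
  by (simp add: kron_vec_def)

lemma kron_vec_carrier [simp]:
  "v \<in> carrier_vec a \<Longrightarrow> w \<in> carrier_vec b \<Longrightarrow> kron_vec v w \<in> carrier_vec (a * b)"
  by (auto intro!: carrier_vecI)

lemma div_mod_less:
  fixes k :: nat
  assumes "k < a * b"
  shows "k div b < a" "k mod b < b"
  using assms by (auto simp: less_mult_imp_div_less intro!: mod_less_divisor gr0I)

lemma scalar_prod_kron_vec:
  fixes v :: "'a :: comm_semiring_0 vec"
  assumes "v \<in> carrier_vec a" "v' \<in> carrier_vec a" "w \<in> carrier_vec b" "w' \<in> carrier_vec b"
  shows "kron_vec v w \<bullet> kron_vec v' w' = (v \<bullet> v') * (w \<bullet> w')"
proof -
  have "kron_vec v w \<bullet> kron_vec v' w' =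
      (\<Sum>k<a * b. (v $ (k div b) * v' $ (k div b)) * (w $ (k mod b) * w' $ (k mod b)))"
    using assms by (simp add: scalar_prod_def kron_vec_def ac_simps flip: lessThan_atLeast0)
  then show ?thesis
    using assms sum_div_mod[of "\<lambda>i. v $ i * v' $ i" b "\<lambda>j. w $ j * w' $ j" a]
    by (simp add: scalar_prod_def flip: lessThan_atLeast0)
qed

lemma hamming_weight_eq_sum: "hamming_weight v = (\<Sum>i<dim_vec v. of_bool (v $ i = 1))"
proof -
  have "{i. i < dim_vec v \<and> v $ i = 1} = {..<dim_vec v} \<inter> {i. v $ i = 1}" by auto
  then show ?thesis
    by (simp add: hamming_weight_def)
qed

lemma hamming_weight_kron_vec:
  "hamming_weight (kron_vec v w) = hamming_weight v * hamming_weight w"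
proof -
  have "hamming_weight (kron_vec v w) = (\<Sum>k<dim_vec v * dim_vec w.
      of_bool (v $ (k div dim_vec w) = 1) * of_bool (w $ (k mod dim_vec w) = 1))"
    unfolding hamming_weight_eq_sum dim_kron_vec
    by (intro sum.cong refl) (auto simp: kron_vec_def)
  also have "\<dots> = hamming_weight v * hamming_weight w"
    unfolding hamming_weight_eq_sum
    by (rule sum_div_mod[of "\<lambda>i. of_bool (v $ i = 1)" _ "\<lambda>j. of_bool (w $ j = 1)"])
  finally show ?thesis .
qed

lemma hamming_weight_append: "hamming_weight (v @\<^sub>v w) = hamming_weight v + hamming_weight w"
proof -
  have lessThan_add: "sum f {..<a + b} = sum f {..<a} + (\<Sum>i<b. f (a + i))"
    for f :: "nat \<Rightarrow> nat" and a b
    by (induction b) simp_all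
  show ?thesis
    by (simp add: hamming_weight_eq_sum lessThan_add del: sum_of_bool_eq)
qed

lemma hamming_weight_unit_vec: "i < n \<Longrightarrow> hamming_weight (unit_vec n i) = 1"
proof -
  assume "i < n"
  then have "{j. j < dim_vec (unit_vec n i) \<and> unit_vec n i $ j = (1 :: bit)} = {i}"
    by (auto split: if_splits)
  then show ?thesis by (simp add: hamming_weight_def)
qed

lemma hamming_weight_zero_vec: "hamming_weight (0\<^sub>v n) = 0"
  by (simp add: hamming_weight_def)

lemma row_kron:
  assumes "i < dim_row A * dim_row B"
  shows "row (kron A B) i = kron_vec (row A (i div dim_row B)) (row B (i mod dim_row B))"
  using assms
  by (intro eq_vecI) (simp_all add: kron_def kron_vec_def div_mod_less)

lemma row_hcat:
  assumes "dim_row A = dim_row B" "i < dim_row A"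
  shows "row (hcat A B) i = row A i @\<^sub>v row B i"
  using assms by (intro eq_vecI) (auto simp: hcat_def)

section \<open>Logical operators of hypergraph product codes\<close>

text \<open>Kernel membership is restated as orthogonality to each row, the form in which
  commutation with the stabilizers is checked.\<close>

lemma slt_basisD:
  assumes "slt_basis A P a" "i \<in> P"
  shows "i < dim_col A" and "a i \<in> carrier_vec (dim_col A)"
    and "\<And>r. r < dim_row A \<Longrightarrow> a i \<bullet> row A r = 0"
    and "\<And>i'. i' \<in> P \<Longrightarrow> a i $ i' = of_bool (i' = i)"
proof -
  interpret kernel "dim_row A" "dim_col A" A by unfold_locales simp
  have "a i \<in> mat_kernel A"
    using assms unfolding slt_basis_def Ker.basis_def by auto
  then have a: "a i \<in> carrier_vec (dim_col A)" "A *\<^sub>v a i = 0\<^sub>v (dim_row A)"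
    by (simp_all add: mat_kernel_def)
  then show "a i \<in> carrier_vec (dim_col A)" by simp
  show "a i \<bullet> row A r = 0" if "r < dim_row A" for r
    using arg_cong[OF a(2), of "\<lambda>v. v $ r"] that a(1) by (simp add: comm_scalar_prod[of _ "dim_col A"])
  show "i < dim_col A"
    using assms unfolding slt_basis_def by auto
  show "a i $ i' = of_bool (i' = i)" if "i' \<in> P" for i'
    using assms that unfolding slt_basis_def by (cases "i' = i") auto
qed

lemma dim_HX [simp]: "dim_row (HX Q) = ma Q * nb Q" "dim_col (HX Q) = hgp_length Q"
  and dim_HZ [simp]: "dim_row (HZ Q) = na Q * mb Q" "dim_col (HZ Q) = hgp_length Q"
  by (simp_all add: HX_def HZ_def hcat_def kron_def hgp_length_def)

lemma row_HX:
  assumes "r < ma Q * nb Q"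
  shows "row (HX Q) r =
    kron_vec (row (HA Q) (r div nb Q)) (unit_vec (nb Q) (r mod nb Q)) @\<^sub>v
    kron_vec (unit_vec (ma Q) (r div nb Q)) (row (transpose_mat (HB Q)) (r mod nb Q))"
proof -
  have "row (HX Q) r = row (kron (HA Q) (1\<^sub>m (nb Q))) r @\<^sub>v row (kron (1\<^sub>m (ma Q)) (transpose_mat (HB Q))) r"
    unfolding HX_def by (rule row_hcat) (use assms in \<open>simp_all add: kron_def\<close>)
  then show ?thesis
    using div_mod_less[OF assms] by (simp only: row_kron[of r] assms index_one_mat index_transpose_mat row_one)
qed

lemma row_HZ:
  assumes "r < na Q * mb Q"
  shows "row (HZ Q) r =
    kron_vec (unit_vec (na Q) (r div mb Q)) (row (HB Q) (r mod mb Q)) @\<^sub>v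
    kron_vec (row (transpose_mat (HA Q)) (r div mb Q)) (unit_vec (mb Q) (r mod mb Q))"
proof -
  have "row (HZ Q) r = row (kron (1\<^sub>m (na Q)) (HB Q)) r @\<^sub>v row (kron (transpose_mat (HA Q)) (1\<^sub>m (mb Q))) r"
    unfolding HZ_def by (rule row_hcat) (use assms in \<open>simp_all add: kron_def\<close>)
  then show ?thesis
    using div_mod_less[OF assms] by (simp only: row_kron[of r] assms index_one_mat index_transpose_mat row_one)
qed

context
  fixes Q :: hgp
  assumes hgp_slt: "hgp_slt Q"
begin

lemma slt_basis_hgp:
  "slt_basis (HA Q) (pivA Q) (basA Q)" "slt_basis (transpose_mat (HA Q)) (pivAT Q) (basAT Q)"
  "slt_basis (HB Q) (pivB Q) (basB Q)" "slt_basis (transpose_mat (HB Q)) (pivBT Q) (basBT Q)"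
  using hgp_slt by (simp_all add: hgp_slt_def)

lemmas pivots = slt_basis_hgp[THEN slt_basisD(1), simplified]
lemmas bases_carrier = slt_basis_hgp[THEN slt_basisD(2), simplified]
lemmas bases_orthogonal = slt_basis_hgp[THEN slt_basisD(3), simplified]
lemmas bases_pivot = slt_basis_hgp[THEN slt_basisD(4)]

lemma logical_qubit_cases:
  assumes "p \<in> logical_qubits Q"
  obtains i h where "p = LeftQ i h" "i \<in> pivA Q" "h \<in> pivB Q"
  | j l where "p = RightQ j l" "j \<in> pivAT Q" "l \<in> pivBT Q"
  using assms unfolding logical_qubits_def by auto

lemma logical_support_carrier:
  assumes "p \<in> logical_qubits Q"
  shows "logical_X_support Q p \<in> carrier_vec (hgp_length Q)"
    and "logical_Z_support Q p \<in> carrier_vec (hgp_length Q)"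
  using assms
  by (auto elim!: logical_qubit_cases simp: hgp_length_def bases_carrier intro!: append_carrier_vec)

text \<open>The scalar product factors over each sector: on the left \<open>basA\<close> is
  orthogonal to the rows of \<open>HA\<close>, on the right \<open>basBT\<close> to those of the
  transpose of \<open>HB\<close>.\<close>

lemma logical_Z_orthogonal_HX:
  assumes "p \<in> logical_qubits Q" "r < ma Q * nb Q"
  shows "logical_Z_support Q p \<bullet> row (HX Q) r = 0"
  using assms(1)
proof (cases rule: logical_qubit_cases)
  case (1 i h)
  then show ?thesis
    using div_mod_less[OF assms(2)] assms(2)
    by (simp add: row_HX scalar_prod_append[of _ "na Q * nb Q" _ "ma Q * mb Q"] bases_carrier
        scalar_prod_kron_vec[of _ "na Q" _ _ "nb Q"] bases_orthogonal)
next
  case (2 j l)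
  then show ?thesis
    using div_mod_less[OF assms(2)] assms(2) bases_orthogonal(4)[of l "r mod nb Q"]
    by (simp add: row_HX scalar_prod_append[of _ "na Q * nb Q" _ "ma Q * mb Q"] bases_carrier
        scalar_prod_kron_vec[of _ "ma Q" _ _ "mb Q"])
qed

lemma logical_X_orthogonal_HZ:
  assumes "p \<in> logical_qubits Q" "r < na Q * mb Q"
  shows "logical_X_support Q p \<bullet> row (HZ Q) r = 0"
  using assms(1)
proof (cases rule: logical_qubit_cases)
  case (1 i h)
  then show ?thesis
    using div_mod_less[OF assms(2)] assms(2)
    by (simp add: row_HZ scalar_prod_append[of _ "na Q * nb Q" _ "ma Q * mb Q"] bases_carrier
        scalar_prod_kron_vec[of _ "na Q" _ _ "nb Q"] bases_orthogonal)
next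
  case (2 j l)
  then show ?thesis
    using div_mod_less[OF assms(2)] assms(2) bases_orthogonal(2)[of j "r div mb Q"]
    by (simp add: row_HZ scalar_prod_append[of _ "na Q * nb Q" _ "ma Q * mb Q"] bases_carrier
        scalar_prod_kron_vec[of _ "ma Q" _ _ "mb Q"])
qed

text \<open>Within a sector the product is one pivot entry of an SLT vector times another, e.g.
  entry i' of \<open>basA Q i\<close> times entry h of \<open>basB Q h'\<close> on the left. Across
  sectors the supports are disjoint.\<close>

lemma logical_supports_dual:
  assumes "p \<in> logical_qubits Q" "p' \<in> logical_qubits Q"
  shows "logical_Z_support Q p \<bullet> logical_X_support Q p' = of_bool (p' = p)"
  using assms
  by (elim logical_qubit_cases)
    (auto simp: scalar_prod_append[of _ "na Q * nb Q" _ "ma Q * mb Q"] bases_carrier pivots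
      scalar_prod_kron_vec[of _ "ma Q" _ _ "mb Q"] scalar_prod_kron_vec[of _ "na Q" _ _ "nb Q"]
      bases_pivot)

text \<open>On the grid of a sector the \<open>X\<close> support lies in a line of one direction and
  the \<open>Z\<close> support in a line of the other. They can meet in a single qubit only, and the
  pivot conditions exclude it unless the logical qubits coincide.\<close>

lemma logical_supports_disjoint:
  assumes "p \<in> logical_qubits Q" "p' \<in> logical_qubits Q" "p \<noteq> p'" "q < hgp_length Q"
  shows "logical_X_support Q p' $ q = 0 \<or> logical_Z_support Q p $ q = 0"
proof (cases "q < na Q * nb Q")
  case True
  note q = div_mod_less[OF True]
  from assms(1) show ?thesis
  proof (cases rule: logical_qubit_cases)
    case p: (1 i h)
    from assms(2) show ?thesis
    proof (cases rule: logical_qubit_cases)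
      case p': (1 i' h')
      show ?thesis
        using True q p p' assms(3) bases_carrier(1)[of i] bases_carrier(3)[of h']
          bases_pivot(1)[of i "q div nb Q"] bases_pivot(3)[of h' "q mod nb Q"]
        by (auto simp: kron_vec_def pivots split: if_splits)
    next
      case p': (2 j' l')
      then show ?thesis using True by simp
    qed
  next
    case (2 j l)
    then show ?thesis using True by simp
  qed
next
  case False
  then obtain k where q: "q = na Q * nb Q + k" and k: "k < ma Q * mb Q"
    using assms(4) by (metis add_less_cancel_left hgp_length_def le_add_diff_inverse not_less)
  note km = div_mod_less[OF k]
  from assms(1) show ?thesis
  proof (cases rule: logical_qubit_cases)
    case p: (2 j l)
    from assms(2) show ?thesis
    proof (cases rule: logical_qubit_cases)
      case p': (2 j' l')
      show ?thesis
        unfolding q using k km p p' assms(3) bases_carrier(4)[of l] bases_carrier(2)[of j']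
          bases_pivot(4)[of l "k mod mb Q"] bases_pivot(2)[of j' "k div mb Q"]
        by (auto simp: kron_vec_def pivots split: if_splits)
    next
      case p': (1 i' h')
      then show ?thesis
        unfolding q using k bases_carrier(3)[of h'] by simp
    qed
  next
    case (1 i h)
    then show ?thesis
      unfolding q using k bases_carrier(1)[of i] by simp
  qed
qed

section \<open>The logical CNOT and its circuit\<close>

lemma implements_CNOT_transvection:
  assumes c: "c \<in> logical_qubits Q" and t: "t \<in> logical_qubits Q" and "c \<noteq> t"
    and U: "circuit_unitary (hgp_length Q) C =
      basis_map_op (hgp_length Q) (transvection (logical_X_support Q t) (logical_Z_support Q c))"
  shows "implements_CNOT Q C c t"
proof -
  define u where "u = logical_X_support Q t"
  define w where "w = logical_Z_support Q c"
  let ?n = "hgp_length Q"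
  have u: "u \<in> carrier_vec ?n" and w: "w \<in> carrier_vec ?n" and wu: "w \<bullet> u = 0"
    using c t \<open>c \<noteq> t\<close> by (simp_all add: u_def w_def logical_support_carrier logical_supports_dual)
  have conj_X: "conj_by (circuit_unitary ?n C) (X_type v) = X_type (transvection u w v)"
    and conj_Z: "conj_by (circuit_unitary ?n C) (Z_type v) = Z_type (transvection w u v)"
    if "v \<in> carrier_vec ?n" for v
    using conj_by_transvection_X_type[OF u w wu that] conj_by_transvection_Z_type[OF u w wu that]
    by (simp_all add: U u_def w_def)
  \<comment> \<open>This settles every operator that must not change: stabilizers by their
    orthogonality to the logical supports, the other logical Paulis by duality.\<close>
  have fixed: "transvection u' w' v = v"
    if "w' \<bullet> v = 0" "u' \<in> carrier_vec ?n" "v \<in> carrier_vec ?n" for u' w' v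
    using that by (intro eq_vecI) (simp_all add: transvection_def)
  have phase: "eq_up_to_phase A A" for A
    unfolding eq_up_to_phase_def by (rule exI[of _ 1]) (auto intro: eq_matI)
  have "conj_by (circuit_unitary ?n C) S = S" if S: "S \<in> stabilizer_generators Q" for S
  proof -
    consider r where "r < ma Q * nb Q" "S = X_type (row (HX Q) r)"
      | r where "r < na Q * mb Q" "S = Z_type (row (HZ Q) r)"
      using S unfolding stabilizer_generators_def rows_def by auto
    then show ?thesis
    proof cases
      case 1
      have "row (HX Q) r \<in> carrier_vec ?n" by (auto intro!: carrier_vecI)
      then show ?thesis
        using 1 u logical_Z_orthogonal_HX[OF c] by (simp add: conj_X fixed w_def)
    next
      case 2
      have "row (HZ Q) r \<in> carrier_vec ?n" by (auto intro!: carrier_vecI)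
      then show ?thesis
        using 2 w logical_X_orthogonal_HZ[OF t] by (simp add: conj_Z fixed u_def)
    qed
  qed
  moreover have "conj_by (circuit_unitary ?n C) (logical_X Q p) = CNOT_X Q c t p"
    if p: "p \<in> logical_qubits Q" for p
  proof (cases "p = c")
    case True
    then have "transvection u w (logical_X_support Q p) = logical_X_support Q c + u"
      using c u by (intro eq_vecI) (auto simp: transvection_def w_def logical_supports_dual)
    then show ?thesis
      using True c t
      by (simp add: logical_X_def CNOT_X_def conj_X logical_support_carrier u_def X_type_mult[of _ ?n])
  next
    case False
    then have "w \<bullet> logical_X_support Q p = 0"
      using c p by (simp add: w_def logical_supports_dual)
    then show ?thesis
      using False p u by (simp add: logical_X_def CNOT_X_def conj_X logical_support_carrier fixed)
  qed
  moreover have "conj_by (circuit_unitary ?n C) (logical_Z Q p) = CNOT_Z Q c t p"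
    if p: "p \<in> logical_qubits Q" for p
  proof -
    \<comment> \<open>On \<open>Z\<close>-type vectors the form being read is \<open>u\<close>, so
      the target is the logical qubit whose \<open>Z\<close> operator is altered.\<close>
    have dual: "u \<bullet> logical_Z_support Q p = of_bool (p = t)"
      using t p logical_supports_dual[OF p t]
        comm_scalar_prod[OF u logical_support_carrier(2)[OF p]] by (auto simp: u_def)
    show ?thesis
    proof (cases "p = t")
      case True
      then have "transvection w u (logical_Z_support Q p) = w + logical_Z_support Q t"
        using w dual comm_add_vec[OF w logical_support_carrier(2)[OF t]]
        by (simp add: transvection_def)
      then show ?thesis
        using True c t
        by (simp add: logical_Z_def CNOT_Z_def conj_Z logical_support_carrier w_def Z_type_mult[of _ ?n])
    next
      case False
      then show ?thesis
        using p w dual by (simp add: logical_Z_def CNOT_Z_def conj_Z logical_support_carrier fixed)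
    qed
  qed
  ultimately show ?thesis
    by (simp add: implements_CNOT_def implements_def Let_def phase)
qed

lemma exists_CNOT_circuit:
  assumes c: "c \<in> logical_qubits Q" and t: "t \<in> logical_qubits Q" and "c \<noteq> t"
  defines "u \<equiv> logical_X_support Q t" and "w \<equiv> logical_Z_support Q c"
  shows "\<exists>C. clifford_circuit (hgp_length Q) C \<and> implements_CNOT Q C c t \<and>
    hamming_weight u \<le> support_size (hgp_length Q) C \<and>
    support_size (hgp_length Q) C \<le> hamming_weight u + hamming_weight w \<and>
    hamming_weight u \<le> depth C \<and> depth C \<le> hamming_weight u + 2 * hamming_weight w"
proof -
  let ?n = "hgp_length Q"
  have u: "u \<in> carrier_vec ?n" and w: "w \<in> carrier_vec ?n"
    using c t by (simp_all add: u_def w_def logical_support_carrier)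
  have disj: "u $ q = 0 \<or> w $ q = 0" if "q < ?n" for q
    using logical_supports_disjoint[OF c t \<open>c \<noteq> t\<close> that] by (simp add: u_def w_def)
  \<comment> \<open>The pairing of \<open>w\<close> with the \<open>X\<close> support of the same
    logical qubit is 1, so some coordinate of \<open>w\<close> is 1; it becomes the accumulator
    \<open>p\<close>.\<close>
  have "w \<bullet> logical_X_support Q c \<noteq> 0"
    using c by (simp add: w_def logical_supports_dual)
  then obtain p where "p < dim_vec (logical_X_support Q c)" "w $ p * logical_X_support Q c $ p \<noteq> 0"
    unfolding scalar_prod_def by (metis (no_types, lifting) atLeastLessThan_iff sum.neutral)
  then have p: "p < ?n" "w $ p = 1"
    using logical_support_carrier(1)[OF c] by auto
  note U = circuit_unitary_parity_cnot[OF u w p disj]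
  have "u $ p = 0"
    using disj[OF p(1)] p(2) by simp
  then show ?thesis
    using clifford_circuit_parity_cnot[OF u w p(1)] support_size_transvection[OF u w p U]
      depth_parity_cnot[where p = p and u = u and w = w] implements_CNOT_transvection[OF c t \<open>c \<noteq> t\<close> U[unfolded u_def w_def]]
    by (intro exI[of _ "parity_cnot p u w"]) (simp add: u_def w_def)
qed

lemma hamming_weight_logical_support:
  "i \<in> pivA Q \<Longrightarrow> hamming_weight (logical_X_support Q (LeftQ i h)) = hamming_weight (basB Q h)"
  "h \<in> pivB Q \<Longrightarrow> hamming_weight (logical_Z_support Q (LeftQ i h)) = hamming_weight (basA Q i)"
  "l \<in> pivBT Q \<Longrightarrow> hamming_weight (logical_X_support Q (RightQ j l)) = hamming_weight (basAT Q j)"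
  by (simp_all add: hamming_weight_append hamming_weight_zero_vec hamming_weight_kron_vec
      hamming_weight_unit_vec pivots)

end

section \<open>Scaling of the circuits\<close>

text \<open>Here \<open>f\<close> is the weight of \<open>u\<close> and \<open>f'\<close> that of
  \<open>w\<close>; \<open>m = 1\<close> serves the support size and \<open>m = 2\<close> the depth,
  where the fan-in occurs twice. The lower constant comes from \<open>f\<close> alone.\<close>

lemma uniformly_Theta_sandwich:
  assumes f: "uniformly_Theta I f g" and f': "uniformly_Theta I f' g"
    and "\<And>k x. x \<in> I k \<Longrightarrow> f k x \<le> F k x" "\<And>k x. x \<in> I k \<Longrightarrow> F k x \<le> f k x + m * f' k x"
  shows "uniformly_Theta I F g"
proof -
  obtain c1 c2 where c: "c1 > 0" "c2 > 0" "\<forall>\<^sub>F k in sequentially. \<forall>x\<in>I k.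
      c1 * g k \<le> real (f k x) \<and> real (f k x) \<le> c2 * g k"
    using f unfolding uniformly_Theta_def by blast
  obtain d1 d2 where d: "d1 > 0" "d2 > 0" "\<forall>\<^sub>F k in sequentially. \<forall>x\<in>I k.
      d1 * g k \<le> real (f' k x) \<and> real (f' k x) \<le> d2 * g k"
    using f' unfolding uniformly_Theta_def by blast
  have "\<forall>\<^sub>F k in sequentially. \<forall>x\<in>I k.
      c1 * g k \<le> real (F k x) \<and> real (F k x) \<le> (c2 + real m * d2) * g k"
    using c(3) d(3)
  proof eventually_elim
    case (elim k)
    show ?case
    proof
      fix x assume x: "x \<in> I k"
      have "c1 * g k \<le> real (F k x)"
        using elim(1) x assms(3)[OF x] by (meson of_nat_mono order_trans)
      moreover have "real (F k x) \<le> real (f k x) + real m * real (f' k x)"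
        using assms(4)[OF x] by (metis of_nat_add of_nat_mono of_nat_mult)
      moreover have "real m * real (f' k x) \<le> real m * (d2 * g k)"
        using elim(2) x by (intro mult_left_mono) auto
      ultimately show "c1 * g k \<le> real (F k x) \<and> real (F k x) \<le> (c2 + real m * d2) * g k"
        using elim(1) x by (auto simp: algebra_simps intro: order_trans add_mono)
    qed
  qed
  moreover have "c2 + real m * d2 > 0"
    using c d by (simp add: add_pos_nonneg)
  ultimately show ?thesis
    using c(1) unfolding uniformly_Theta_def by blast
qed

text \<open>The weight of a logical operator depends on one pivot only; \<open>h\<close> extracts it
  from a pair of logical qubits, and the constants carry over.\<close>

lemma uniformly_Theta_reindex:
  assumes "uniformly_Theta J f g" "\<And>k x. x \<in> I k \<Longrightarrow> h x \<in> J k \<and> F k x = f k (h x)"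
  shows "uniformly_Theta I F g"
proof -
  obtain c1 c2 where "c1 > 0" "c2 > 0" and ev: "\<forall>\<^sub>F k in sequentially. \<forall>x\<in>J k.
      c1 * g k \<le> real (f k x) \<and> real (f k x) \<le> c2 * g k"
    using assms(1) unfolding uniformly_Theta_def by blast
  moreover from ev have "\<forall>\<^sub>F k in sequentially. \<forall>x\<in>I k.
      c1 * g k \<le> real (F k x) \<and> real (F k x) \<le> c2 * g k"
    by eventually_elim (use assms(2) in auto)
  ultimately show ?thesis
    unfolding uniformly_Theta_def by blast
qed

lemma targeted_CNOT_family_exists:
  assumes slt: "\<And>k. hgp_slt (Q k)"
    and pairs: "\<And>k c t. (c, t) \<in> pairs (Q k) \<Longrightarrow>
      c \<in> logical_qubits (Q k) \<and> t \<in> logical_qubits (Q k) \<and> c \<noteq> t"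
    and weight_X: "uniformly_Theta (\<lambda>k. pairs (Q k))
      (\<lambda>k x. hamming_weight (logical_X_support (Q k) (snd x))) (sqrt_length Q)"
    and weight_Z: "uniformly_Theta (\<lambda>k. pairs (Q k))
      (\<lambda>k x. hamming_weight (logical_Z_support (Q k) (fst x))) (sqrt_length Q)"
  shows "\<exists>C. targeted_CNOT_family Q pairs C"
proof -
  have "\<exists>C. \<forall>k x. x \<in> pairs (Q k) \<longrightarrow>
    clifford_circuit (hgp_length (Q k)) (C k x) \<and> implements_CNOT (Q k) (C k x) (fst x) (snd x) \<and>
    hamming_weight (logical_X_support (Q k) (snd x)) \<le> support_size (hgp_length (Q k)) (C k x) \<and>
    support_size (hgp_length (Q k)) (C k x) \<le> hamming_weight (logical_X_support (Q k) (snd x)) +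
      hamming_weight (logical_Z_support (Q k) (fst x)) \<and>
    hamming_weight (logical_X_support (Q k) (snd x)) \<le> depth (C k x) \<and>
    depth (C k x) \<le> hamming_weight (logical_X_support (Q k) (snd x)) +
      2 * hamming_weight (logical_Z_support (Q k) (fst x))"
    using exists_CNOT_circuit[OF slt] pairs by (intro choice allI) (metis prod.collapse)
  then obtain C where C: "\<And>k x. x \<in> pairs (Q k) \<Longrightarrow>
    clifford_circuit (hgp_length (Q k)) (C k x) \<and> implements_CNOT (Q k) (C k x) (fst x) (snd x) \<and>
    hamming_weight (logical_X_support (Q k) (snd x)) \<le> support_size (hgp_length (Q k)) (C k x) \<and>
    support_size (hgp_length (Q k)) (C k x) \<le> hamming_weight (logical_X_support (Q k) (snd x)) +
      hamming_weight (logical_Z_support (Q k) (fst x)) \<and>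
    hamming_weight (logical_X_support (Q k) (snd x)) \<le> depth (C k x) \<and>
    depth (C k x) \<le> hamming_weight (logical_X_support (Q k) (snd x)) +
      2 * hamming_weight (logical_Z_support (Q k) (fst x))"
    by blast
  have "uniformly_Theta (\<lambda>k. pairs (Q k))
      (\<lambda>k x. support_size (hgp_length (Q k)) (C k x)) (sqrt_length Q)"
    by (rule uniformly_Theta_sandwich[OF weight_X weight_Z, where m = 1]) (use C in auto)
  moreover have "uniformly_Theta (\<lambda>k. pairs (Q k)) (\<lambda>k x. depth (C k x)) (sqrt_length Q)"
    by (rule uniformly_Theta_sandwich[OF weight_X weight_Z, where m = 2]) (use C in auto)
  ultimately show ?thesis
    using C unfolding targeted_CNOT_family_def by (intro exI[of _ C]) fastforce
qed

theorem theorem4p8: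
  fixes Q :: "nat \<Rightarrow> hgp"
  assumes "\<And>k. hgp_slt (Q k)"
    and "scaling Q"
  shows "(\<exists>C. targeted_CNOT_family Q same_sector_pairs C) \<and>
         (\<exists>C. targeted_CNOT_family Q cross_sector_pairs C)"
proof -
  have A: "uniformly_Theta (\<lambda>k. pivA (Q k)) (\<lambda>k i. hamming_weight (basA (Q k) i)) (sqrt_length Q)"
    and AT: "uniformly_Theta (\<lambda>k. pivAT (Q k)) (\<lambda>k j. hamming_weight (basAT (Q k) j)) (sqrt_length Q)"
    and B: "uniformly_Theta (\<lambda>k. pivB (Q k)) (\<lambda>k h. hamming_weight (basB (Q k) h)) (sqrt_length Q)"
    using assms(2) by (simp_all add: scaling_def)
  note weights = hamming_weight_logical_support[OF assms(1)]
  have "\<exists>C. targeted_CNOT_family Q same_sector_pairs C"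
  proof (rule targeted_CNOT_family_exists[OF assms(1)])
    \<comment> \<open>The target's \<open>X\<close> support is a unit vector times
      \<open>basB\<close> at its second pivot. The missing case of \<open>h\<close> is undefined,
      but a left-sector target never reaches it.\<close>
    show "uniformly_Theta (\<lambda>k. same_sector_pairs (Q k))
        (\<lambda>k x. hamming_weight (logical_X_support (Q k) (snd x))) (sqrt_length Q)"
      by (rule uniformly_Theta_reindex[OF B, where h = "\<lambda>(c, t). case t of LeftQ i h \<Rightarrow> h"])
        (auto simp: same_sector_pairs_def weights simp del: logical_X_support.simps)
    show "uniformly_Theta (\<lambda>k. same_sector_pairs (Q k))
        (\<lambda>k x. hamming_weight (logical_Z_support (Q k) (fst x))) (sqrt_length Q)"
      by (rule uniformly_Theta_reindex[OF A, where h = "\<lambda>(c, t). case c of LeftQ i h \<Rightarrow> i"])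
        (auto simp: same_sector_pairs_def weights simp del: logical_Z_support.simps)
  qed (auto simp: same_sector_pairs_def logical_qubits_def)
  moreover have "\<exists>C. targeted_CNOT_family Q cross_sector_pairs C"
  proof (rule targeted_CNOT_family_exists[OF assms(1)])
    \<comment> \<open>The target now lies in the right sector, where the weight of its
      \<open>X\<close> support is that of \<open>basAT\<close>; the control is treated as
      before.\<close>
    show "uniformly_Theta (\<lambda>k. cross_sector_pairs (Q k))
        (\<lambda>k x. hamming_weight (logical_X_support (Q k) (snd x))) (sqrt_length Q)"
      by (rule uniformly_Theta_reindex[OF AT, where h = "\<lambda>(c, t). case t of RightQ j l \<Rightarrow> j"])
        (auto simp: cross_sector_pairs_def weights simp del: logical_X_support.simps)
    show "uniformly_Theta (\<lambda>k. cross_sector_pairs (Q k))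
        (\<lambda>k x. hamming_weight (logical_Z_support (Q k) (fst x))) (sqrt_length Q)"
      by (rule uniformly_Theta_reindex[OF A, where h = "\<lambda>(c, t). case c of LeftQ i h \<Rightarrow> i"])
        (auto simp: cross_sector_pairs_def weights simp del: logical_Z_support.simps)
  qed (auto simp: cross_sector_pairs_def logical_qubits_def)
  ultimately show ?thesis ..
qed

end
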